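(* Let $p$ be a prime, $n=p^2$, and let $\Gamma=\Gamma(D_{2n})$ be the intersection graph of $D_{2n}$. Then the Wiener index of $\Gamma$ is $W(\Gamma)=\frac{1}{2}(3p^4+3p^3+5p^2+3p+2)$.
   Context: $D_{2n}=\langle r,s : r^n=s^2=1,\ srs=r^{-1}\rangle$ is the dihedral group of order $2n$. The intersection graph $\Gamma(G)$ of a finite group $G$ has as vertices the proper non-trivial subgroups of $G$, two distinct vertices being adjacent iff their intersection is non-trivial. The Wiener index is $W(\Gamma)=\sum_{\{u,v\}\subseteq V(\Gamma)} d(u,v)$, summed over unordered pairs of distinct vertices, where $d$ is graph distance. *)

theory Defs
  imports
    "HOL-Algebra.Algebra"
    "HOL-Computational_Algebra.Primes"
    "Graph_Theory.Graph_Theory"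
begin

section \<open>Groups given by generators and relations\<close>

text \<open>
  A word over the generators and their formal inverses: \<open>(x, True)\<close> stands for the
  generator \<open>x\<close> and \<open>(x, False)\<close> for its inverse.
\<close>

type_synonym 'a gword = "('a \<times> bool) list"

text \<open>
  A pair \<open>(u, v)\<close> in the set \<open>R\<close> is the defining relation \<open>u = v\<close>. All elements of the
  type \<open>'a\<close> are generators. The quotient of the monoid of words by the congruence below is
  the free group on \<open>'a\<close> modulo the normal closure of all \<open>u v\<inverse>\<close>, for \<open>(u, v)\<close> in \<open>R\<close>.
\<close>

inductive gword_eq :: "('a gword \<times> 'a gword) set \<Rightarrow> 'a gword \<Rightarrow> 'a gword \<Rightarrow> bool"
  for R where
  relation: "(u, v) \<in> R \<Longrightarrow> gword_eq R u v"
| cancel: "gword_eq R [(x, b), (x, \<not> b)] []"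
| append: "gword_eq R u u' \<Longrightarrow> gword_eq R v v' \<Longrightarrow> gword_eq R (u @ v) (u' @ v')"
| refl: "gword_eq R u u"
| sym: "gword_eq R u v \<Longrightarrow> gword_eq R v u"
| trans: "gword_eq R u v \<Longrightarrow> gword_eq R v w \<Longrightarrow> gword_eq R u w"

definition gword_rel :: "('a gword \<times> 'a gword) set \<Rightarrow> ('a gword \<times> 'a gword) set" where
  "gword_rel R = {(u, v). gword_eq R u v}"

definition presented_group :: "('a gword \<times> 'a gword) set \<Rightarrow> 'a gword set monoid" where
  "presented_group R =
     \<lparr>carrier = UNIV // gword_rel R,
      monoid.mult = (\<lambda>A B. \<Union>u\<in>A. \<Union>v\<in>B. gword_rel R `` {u @ v}),
      monoid.one = gword_rel R `` {[]}\<rparr>"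

lemma equiv_gword_rel: "equiv UNIV (gword_rel R)"
  by (auto intro!: equivI refl_onI symI transI simp: gword_rel_def
      intro: gword_eq.refl gword_eq.sym gword_eq.trans)

lemma presented_group_mult:
  "(gword_rel R `` {u}) \<otimes>\<^bsub>presented_group R\<^esub> (gword_rel R `` {v}) = gword_rel R `` {u @ v}"
proof -
  let ?A = "gword_rel R `` {u}" and ?B = "gword_rel R `` {v}"
  have "gword_rel R `` {u' @ v'} = gword_rel R `` {u @ v}" if "u' \<in> ?A" "v' \<in> ?B" for u' v'
    using that
    by (intro equiv_class_eq[OF equiv_gword_rel])
      (auto simp: gword_rel_def intro: gword_eq.append gword_eq.sym)
  then have "(\<Union>u'\<in>?A. \<Union>v'\<in>?B. gword_rel R `` {u' @ v'}) =
      (\<Union>u'\<in>?A. \<Union>v'\<in>?B. gword_rel R `` {u @ v})"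
    by (intro SUP_cong HOL.refl)
  moreover have "?A \<noteq> {}" "?B \<noteq> {}"
    using equiv_class_self[OF equiv_gword_rel] by (metis UNIV_I empty_iff)+
  ultimately show ?thesis
    by (simp add: presented_group_def)
qed

lemma gword_eq_inverse: "gword_eq R (rev (map (map_prod id Not) w) @ w) []"
proof (induction w)
  case Nil
  show ?case by (simp add: gword_eq.refl)
next
  case (Cons l w)
  obtain x b where l: "l = (x, b)" by (cases l)
  let ?w' = "rev (map (map_prod id Not) w)"
  have "gword_eq R [(x, \<not> b), (x, b)] []"
    using gword_eq.cancel[of R x "\<not> b"] by simp
  then have "gword_eq R (?w' @ [(x, \<not> b), (x, b)] @ w) (?w' @ [] @ w)"
    by (intro gword_eq.append gword_eq.refl)
  then have "gword_eq R (?w' @ [(x, \<not> b), (x, b)] @ w) []"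
    using Cons.IH unfolding append_Nil by (rule gword_eq.trans)
  then show ?case by (simp add: l id_def)
qed

lemma group_presented_group: "group (presented_group R)"
proof (rule groupI)
  let ?G = "presented_group R"
  have carr: "\<exists>w. A = gword_rel R `` {w}" if "A \<in> carrier ?G" for A
    using that by (auto simp: presented_group_def elim: quotientE)
  have cls: "gword_rel R `` {w} \<in> carrier ?G" for w
    by (auto simp: presented_group_def intro: quotientI)
  have one: "\<one>\<^bsub>?G\<^esub> = gword_rel R `` {[]}"
    by (simp add: presented_group_def)
  show "\<one>\<^bsub>?G\<^esub> \<in> carrier ?G"
    by (simp add: one cls)
  fix A assume A: "A \<in> carrier ?G"
  then obtain u where u: "A = gword_rel R `` {u}" using carr by blast
  show "\<one>\<^bsub>?G\<^esub> \<otimes>\<^bsub>?G\<^esub> A = A"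
    by (simp add: one u presented_group_mult)
  have "gword_rel R `` {rev (map (map_prod id Not) u) @ u} = gword_rel R `` {[]}"
    by (intro equiv_class_eq[OF equiv_gword_rel]) (simp add: gword_rel_def gword_eq_inverse)
  then show "\<exists>B\<in>carrier ?G. B \<otimes>\<^bsub>?G\<^esub> A = \<one>\<^bsub>?G\<^esub>"
    using cls by (auto simp: one u presented_group_mult
        intro!: bexI[of _ "gword_rel R `` {rev (map (map_prod id Not) u)}"])
  fix B assume "B \<in> carrier ?G"
  then obtain v where v: "B = gword_rel R `` {v}" using carr by blast
  show "A \<otimes>\<^bsub>?G\<^esub> B \<in> carrier ?G"
    by (simp add: u v presented_group_mult cls)
  fix C assume "C \<in> carrier ?G"
  then obtain w where w: "C = gword_rel R `` {w}" using carr by blast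
  show "(A \<otimes>\<^bsub>?G\<^esub> B) \<otimes>\<^bsub>?G\<^esub> C = A \<otimes>\<^bsub>?G\<^esub> (B \<otimes>\<^bsub>?G\<^esub> C)"
    by (simp add: u v w presented_group_mult)
qed


section \<open>The dihedral group of order \<open>2n\<close>\<close>

datatype dihedral_gen = Gen_r | Gen_s

definition dihedral_rels :: "nat \<Rightarrow> (dihedral_gen gword \<times> dihedral_gen gword) set" where
  "dihedral_rels n =
     {(replicate n (Gen_r, True), []),
      ([(Gen_s, True), (Gen_s, True)], []),
      ([(Gen_s, True), (Gen_r, True), (Gen_s, True)], [(Gen_r, False)])}"

definition dihedral_group :: "nat \<Rightarrow> dihedral_gen gword set monoid" where
  "dihedral_group n = presented_group (dihedral_rels n)"


section \<open>Intersection graph and Wiener index\<close>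

text \<open>Undirected graphs are symmetric digraphs, as in the Graph-Theory entry.\<close>

definition intersection_graph :: "('a, 'b) monoid_scheme \<Rightarrow> 'a set pair_pre_digraph" where
  "intersection_graph G =
    (let V = {H. subgroup H G \<and> H \<noteq> carrier G \<and> H \<noteq> {\<one>\<^bsub>G\<^esub>}}
     in \<lparr>pverts = V, parcs = {(H, K). H \<in> V \<and> K \<in> V \<and> H \<noteq> K \<and> H \<inter> K \<noteq> {\<one>\<^bsub>G\<^esub>}}\<rparr>)"

lemma pair_graph_intersection_graph:
  assumes "finite (carrier G)"
  shows "pair_graph (intersection_graph G)"
proof -
  define V where "V = {H. subgroup H G \<and> H \<noteq> carrier G \<and> H \<noteq> {\<one>\<^bsub>G\<^esub>}}"
  define E where "E = {(H, K). H \<in> V \<and> K \<in> V \<and> H \<noteq> K \<and> H \<inter> K \<noteq> {\<one>\<^bsub>G\<^esub>}}"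
  have eq: "intersection_graph G = \<lparr>pverts = V, parcs = E\<rparr>"
    by (simp add: intersection_graph_def V_def E_def Let_def)
  have "V \<subseteq> Pow (carrier G)"
    using subgroup.subset unfolding V_def by blast
  then have fin: "finite V"
    using assms by (meson finite_Pow_iff finite_subset)
  have "E \<subseteq> V \<times> V"
    unfolding E_def by blast
  then have finE: "finite E"
    using fin by (meson finite_SigmaI finite_subset)
  have ends: "fst e \<in> V" "snd e \<in> V" "fst e \<noteq> snd e" if "e \<in> E" for e
    using that unfolding E_def by auto
  have "sym E"
    unfolding sym_def E_def by blast
  then have sym: "symmetric (with_proj \<lparr>pverts = V, parcs = E\<rparr>)"
    unfolding symmetric_def by simp
  have wf: "pair_wf_digraph \<lparr>pverts = V, parcs = E\<rparr>"
    by (rule pair_wf_digraph.intro) (simp_all add: ends)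
  show ?thesis
    unfolding eq
    by (intro pair_graph.intro pair_digraph.intro pair_pseudo_graph.intro pair_fin_digraph.intro
        pair_sym_digraph.intro pair_loopfree_digraph.intro pair_fin_digraph_axioms.intro
        pair_sym_digraph_axioms.intro pair_loopfree_digraph_axioms.intro wf sym)
      (simp_all add: fin finE ends)
qed

text \<open>
  Length of a shortest walk, which is \<open>\<infinity>\<close> if there is none. The values are extended reals so
  that disconnected graphs get an infinite Wiener index.
\<close>

definition graph_dist :: "'a pair_pre_digraph \<Rightarrow> 'a \<Rightarrow> 'a \<Rightarrow> ereal" where
  "graph_dist \<Gamma> u v = wf_digraph.\<mu> (with_proj \<Gamma>) (\<lambda>_. 1) u v"

text \<open>
  The sum ranges over the two-element sets of vertices. The definite description is
  meaningful because the distance is symmetric in an undirected graph.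
\<close>

definition Wiener_index :: "'a pair_pre_digraph \<Rightarrow> ereal" where
  "Wiener_index \<Gamma> =
    (\<Sum>e\<in>{e. e \<subseteq> pverts \<Gamma> \<and> card e = 2}. THE d. \<exists>u v. e = {u, v} \<and> d = graph_dist \<Gamma> u v)"

lemma graph_dist_commute:
  assumes "pair_sym_digraph \<Gamma>"
  shows "graph_dist \<Gamma> u v = graph_dist \<Gamma> v u"
proof -
  interpret pair_sym_digraph \<Gamma> by fact
  have rev_walk: "\<exists>q. awalk y q x \<and> length q = length p" if "awalk x p y" for x p y
    using that
  proof (induction p arbitrary: x)
    case Nil
    then show ?case by (auto simp: awalk_Nil_iff)
  next
    case (Cons a p)
    then obtain q where q: "awalk y q (snd a)" "length q = length p"
      by (auto simp: awalk_Cons_iff)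
    have "(snd a, x) \<in> parcs \<Gamma>"
      using Cons.prems by (auto simp: awalk_Cons_iff intro: arcs_symmetric)
    then have "awalk (snd a) [(snd a, x)] x"
      by (auto simp: awalk_Cons_iff awalk_Nil_iff dest: in_arcsD1 in_arcsD2)
    with q have "awalk y (q @ [(snd a, x)]) x" by auto
    with q show ?case by (metis length_append_singleton length_Cons)
  qed
  have "awalk_cost (\<lambda>_. 1) p = real (length p)" for p
    by (induction p) auto
  then have dist: "graph_dist \<Gamma> x y = (INF p\<in>{p. awalk x p y}. ereal (real (length p)))" for x y
    by (simp add: graph_dist_def \<mu>_def)
  have "graph_dist \<Gamma> x y \<le> graph_dist \<Gamma> y x" for x y
    unfolding dist by (rule INF_mono) (use rev_walk in force)
  then show ?thesis by (meson antisym)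
qed

lemma Wiener_index_summand:
  assumes "pair_sym_digraph \<Gamma>"
  shows "(THE d. \<exists>x y. {u, v} = {x, y} \<and> d = graph_dist \<Gamma> x y) = graph_dist \<Gamma> u v"
proof (rule the_equality)
  show "\<exists>x y. {u, v} = {x, y} \<and> graph_dist \<Gamma> u v = graph_dist \<Gamma> x y"
    by blast
next
  fix d assume "\<exists>x y. {u, v} = {x, y} \<and> d = graph_dist \<Gamma> x y"
  then show "d = graph_dist \<Gamma> u v"
    using graph_dist_commute[OF assms] by (metis doubleton_eq_iff)
qed

end

theory Submission
  imports Defs
begin

text \<open>
  The vertices are the rotation groups \<open>\<langle>r\<rangle>\<close> and \<open>\<langle>r\<^sup>p\<rangle>\<close>, the \<open>p\<close> subgroups \<open>\<langle>r\<^sup>p, r\<^sup>i s\<rangle>\<close> of order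
  \<open>2p\<close> and the \<open>p\<^sup>2\<close> subgroups \<open>\<langle>r\<^sup>j s\<rangle>\<close> of order 2. All but the last kind contain \<open>r\<^sup>p\<close> and so form
  a clique, while \<open>\<langle>r\<^sup>j s\<rangle>\<close> is a leaf attached to \<open>\<langle>r\<^sup>p, r\<^sup>i s\<rangle>\<close> for \<open>i = j mod p\<close>. Hence all
  distances are at most 3, and the distances from a vertex sum up to \<open>1 + p + 2p\<^sup>2\<close> for a rotation
  group, \<open>1 + 2p\<^sup>2\<close> for order \<open>2p\<close> and \<open>3p\<^sup>2 + p + 1\<close> for order 2.
\<close>

section \<open>Distances in undirected graphs\<close>

context pair_wf_digraph
begin

text \<open>With unit arc costs, the infimum that defines the distance runs over walk lengths, so a
  walk of least length attains it.\<close>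

lemma graph_dist_eqI:
  assumes walk: "awalk u q v"
    and minimal: "\<And>q'. awalk u q' v \<Longrightarrow> length q \<le> length q'"
  shows "graph_dist G u v = ereal (real (length q))"
proof -
  have "awalk_cost (\<lambda>_. 1) q' = real (length q')" for q'
    by (induction q') auto
  then have "graph_dist G u v = (INF q'\<in>{q'. awalk u q' v}. ereal (real (length q')))"
    by (simp add: graph_dist_def \<mu>_def)
  also have "\<dots> = ereal (real (length q))"
    by (rule INF_eqI) (use walk minimal in auto)
  finally show ?thesis .
qed

lemma awalk_arcI: "(u, v) \<in> parcs G \<Longrightarrow> awalk u [(u, v)] v"
  by (auto simp: awalk_Cons_iff awalk_Nil_iff dest: in_arcsD1 in_arcsD2)

lemma awalk_Cons_arcI: "(u, v) \<in> parcs G \<Longrightarrow> awalk v q w \<Longrightarrow> awalk u ((u, v) # q) w"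
  by (auto simp: awalk_Cons_iff)

lemma graph_dist_eq_1:
  assumes "(u, v) \<in> parcs G" "u \<noteq> v"
  shows "graph_dist G u v = ereal 1"
proof -
  have "length [(u, v)] \<le> length q" if "awalk u q v" for q
    using that assms(2) by (cases q) (auto simp: awalk_Nil_iff)
  from graph_dist_eqI[OF awalk_arcI[OF assms(1)] this] show ?thesis by simp
qed

lemma graph_dist_eq_2:
  assumes "(u, w) \<in> parcs G" "(w, v) \<in> parcs G" "u \<noteq> v" "(u, v) \<notin> parcs G"
  shows "graph_dist G u v = ereal 2"
proof -
  have "length [(u, w), (w, v)] \<le> length q" if "awalk u q v" for q
  proof (rule ccontr)
    assume "\<not> ?thesis"
    then have "length q < 2" by simp
    then have "length q = 0 \<or> length q = 1" by linarith
    then show False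
      using that assms(3,4) by (auto simp: awalk_Nil_iff awalk_Cons_iff length_Suc_conv)
  qed
  from graph_dist_eqI[OF awalk_Cons_arcI[OF assms(1) awalk_arcI[OF assms(2)]] this]
  show ?thesis by simp
qed

text \<open>The last three hypotheses exclude walks of length 0, 1 and 2 in turn: distinct ends, no
  arc between them, no common neighbour.\<close>

lemma graph_dist_eq_3:
  assumes "(u, w) \<in> parcs G" "(w, w') \<in> parcs G" "(w', v) \<in> parcs G"
    and "u \<noteq> v" "(u, v) \<notin> parcs G"
    and "\<And>x. (u, x) \<in> parcs G \<Longrightarrow> (x, v) \<notin> parcs G"
  shows "graph_dist G u v = ereal 3"
proof -
  have "length [(u, w), (w, w'), (w', v)] \<le> length q" if "awalk u q v" for q
  proof (rule ccontr)
    assume "\<not> ?thesis"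
    then have "length q < 3" by simp
    then have "length q = 0 \<or> length q = 1 \<or> length q = 2" by linarith
    then show False
      using that assms(4-6)
      by (auto simp: awalk_Nil_iff awalk_Cons_iff length_Suc_conv numeral_2_eq_2)
  qed
  from graph_dist_eqI[OF awalk_Cons_arcI[OF assms(1) awalk_Cons_arcI[OF assms(2)
      awalk_arcI[OF assms(3)]]] this]
  show ?thesis by simp
qed

end

section \<open>The Wiener index as half a sum over ordered pairs\<close>

lemma sum_two_subsets:
  fixes D :: "'a set \<Rightarrow> real"
  assumes "finite V"
  shows "2 * (\<Sum>e\<in>{e. e \<subseteq> V \<and> card e = 2}. D e) =
    (\<Sum>u\<in>V. \<Sum>v\<in>V. if u = v then 0 else D {u, v})"
proof -
  define P where "P = {(u, v). u \<in> V \<and> v \<in> V \<and> u \<noteq> v}"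
  have finP: "finite P"
    by (rule finite_subset[of _ "V \<times> V"]) (use assms in \<open>auto simp: P_def\<close>)
  let ?E = "{e. e \<subseteq> V \<and> card e = 2}"
  have img: "(\<lambda>(u, v). {u, v}) ` P = ?E"
    by (force simp: P_def card_2_iff)
  have "(\<Sum>u\<in>V. \<Sum>v\<in>V. if u = v then 0 else D {u, v}) =
      (\<Sum>(u, v)\<in>V \<times> V. if u = v then 0 else D {u, v})"
    by (rule sum.cartesian_product)
  also have "\<dots> = (\<Sum>(u, v)\<in>P. D {u, v})"
    by (rule sum.mono_neutral_cong_right) (use assms in \<open>auto simp: P_def\<close>)
  \<comment> \<open>Double counting: ordered pairs are grouped by their underlying set, and each
    two-element set \<open>{a, b}\<close> comes from exactly \<open>(a, b)\<close> and
    \<open>(b, a)\<close>.\<close>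
  also have "\<dots> = (\<Sum>e\<in>?E. \<Sum>(u, v)\<in>{x \<in> P. (\<lambda>(u, v). {u, v}) x = e}. D {u, v})"
    using sum.image_gen[OF finP, of "\<lambda>(u, v). D {u, v}" "\<lambda>(u, v). {u, v}"] img by simp
  also have "\<dots> = (\<Sum>e\<in>?E. 2 * D e)"
  proof (rule sum.cong[OF HOL.refl])
    fix e assume e: "e \<in> ?E"
    then obtain a b where ab: "e = {a, b}" "a \<noteq> b" by (auto simp: card_2_iff)
    have "{x \<in> P. (\<lambda>(u, v). {u, v}) x = e} = {(a, b), (b, a)}"
      using e ab by (auto simp: P_def doubleton_eq_iff)
    then show "(\<Sum>(u, v)\<in>{x \<in> P. (\<lambda>(u, v). {u, v}) x = e}. D {u, v}) = 2 * D e"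
      using ab by (simp add: insert_commute)
  qed
  finally show ?thesis by (simp add: sum_distrib_left)
qed

text \<open>Replaces the sum of extended reals over two-element sets by a real double sum, which can
  be evaluated row by row. The value 0 on the diagonal lets both sums range over all
  vertices.\<close>

lemma Wiener_index_eq_sum:
  fixes d :: "'a \<Rightarrow> 'a \<Rightarrow> real"
  assumes "pair_graph \<Gamma>"
    and d: "\<And>u v. u \<in> pverts \<Gamma> \<Longrightarrow> v \<in> pverts \<Gamma> \<Longrightarrow> u \<noteq> v \<Longrightarrow> graph_dist \<Gamma> u v = ereal (d u v)"
    and diag: "\<And>u. d u u = 0"
  shows "Wiener_index \<Gamma> = ereal ((\<Sum>u\<in>pverts \<Gamma>. \<Sum>v\<in>pverts \<Gamma>. d u v) / 2)"
proof -
  interpret pair_graph \<Gamma> by fact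
  define D where "D e = (THE r. \<exists>u v. e = {u, v} \<and> r = graph_dist \<Gamma> u v)" for e
  have D: "D {u, v} = graph_dist \<Gamma> u v" for u v
    unfolding D_def by (rule Wiener_index_summand) (rule pair_sym_digraph_axioms)
  \<comment> \<open>Every summand is finite, so passing to reals loses nothing.\<close>
  have D_real: "D e = ereal (real_of_ereal (D e))" if "e \<subseteq> pverts \<Gamma>" "card e = 2" for e
    using that by (auto simp: card_2_iff D d)
  have "Wiener_index \<Gamma> = (\<Sum>e\<in>{e. e \<subseteq> pverts \<Gamma> \<and> card e = 2}. D e)"
    by (simp add: Wiener_index_def D_def)
  also have "\<dots> = (\<Sum>e\<in>{e. e \<subseteq> pverts \<Gamma> \<and> card e = 2}. ereal (real_of_ereal (D e)))"
    by (rule sum.cong) (use D_real in auto)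
  also have "\<dots> = ereal (\<Sum>e\<in>{e. e \<subseteq> pverts \<Gamma> \<and> card e = 2}. real_of_ereal (D e))"
    by simp
  also have "(\<Sum>e\<in>{e. e \<subseteq> pverts \<Gamma> \<and> card e = 2}. real_of_ereal (D e)) =
      (\<Sum>u\<in>pverts \<Gamma>. \<Sum>v\<in>pverts \<Gamma>. if u = v then 0 else real_of_ereal (D {u, v})) / 2"
    using sum_two_subsets[OF pair_finite_verts, of "\<lambda>e. real_of_ereal (D e)"] by linarith
  also have "(\<Sum>u\<in>pverts \<Gamma>. \<Sum>v\<in>pverts \<Gamma>. if u = v then 0 else real_of_ereal (D {u, v})) =
      (\<Sum>u\<in>pverts \<Gamma>. \<Sum>v\<in>pverts \<Gamma>. d u v)"
    by (intro sum.cong) (auto simp: D d diag)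
  finally show ?thesis .
qed

section \<open>Dihedral groups\<close>

text \<open>\<open>rot a\<close> stands for r^a and \<open>ref a\<close> for r^a s. Exponents are
  arbitrary integers rather than residues, so the product rules need no reduction; \<open>n\<close>
  enters the arithmetic through the equality conditions.\<close>

locale dihedral = group G for G (structure) +
  fixes rot ref :: "int \<Rightarrow> 'a" and n :: nat
  assumes n_pos: "n > 0"
    and carrier_eq: "carrier G = range rot \<union> range ref"
    and rot_0: "rot 0 = \<one>"
    and rot_rot: "rot a \<otimes> rot b = rot (a + b)"
    and rot_ref: "rot a \<otimes> ref b = ref (a + b)"
    and ref_rot: "ref a \<otimes> rot b = ref (a - b)"
    and ref_ref: "ref a \<otimes> ref b = rot (a - b)"
    and rot_eq_iff: "rot a = rot b \<longleftrightarrow> int n dvd a - b"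
    and ref_eq_iff: "ref a = ref b \<longleftrightarrow> int n dvd a - b"
    and rot_neq_ref: "rot a \<noteq> ref b"
begin

lemma rot_closed [simp]: "rot a \<in> carrier G" and ref_closed [simp]: "ref a \<in> carrier G"
  by (auto simp: carrier_eq)

lemma inv_rot: "inv (rot a) = rot (- a)"
  by (rule inv_equality) (auto simp: rot_rot rot_0)

lemma inv_ref: "inv (ref a) = ref a"
  by (rule inv_equality) (auto simp: ref_ref rot_0)

lemma rot_eq_one_iff: "rot a = \<one> \<longleftrightarrow> int n dvd a"
  using rot_eq_iff[of a 0] by (simp add: rot_0)

lemma ref_neq_one: "ref a \<noteq> \<one>"
  using rot_neq_ref[of 0 a] by (simp add: rot_0)

lemma finite_carrier: "finite (carrier G)"
proof -
  have "rot a \<in> rot ` {0..<int n}" "ref a \<in> ref ` {0..<int n}" for a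
    using n_pos
    by (auto intro!: image_eqI[of _ _ "a mod int n"] simp: rot_eq_iff ref_eq_iff minus_mod_eq_mult_div)
  then have "carrier G \<subseteq> rot ` {0..<int n} \<union> ref ` {0..<int n}"
    by (auto simp: carrier_eq)
  then show ?thesis by (rule finite_subset) auto
qed

lemma set_eqI:
  assumes "H \<subseteq> carrier G" "K \<subseteq> carrier G"
    and "\<And>a. rot a \<in> H \<longleftrightarrow> rot a \<in> K" "\<And>a. ref a \<in> H \<longleftrightarrow> ref a \<in> K"
  shows "H = K"
  using assms by (auto simp: carrier_eq)

section \<open>The subgroups of a dihedral group\<close>

definition Rot :: "nat \<Rightarrow> 'a set" where
  "Rot d = rot ` {a. int d dvd a}"

text \<open>For \<open>d\<close> dividing \<open>n\<close> this is the subgroup generated by r^d and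
  r^b s. The extreme cases are the whole group for \<open>d = 1\<close> and the group of order 2
  generated by r^b s for \<open>d = n\<close>.\<close>

definition Dih :: "nat \<Rightarrow> int \<Rightarrow> 'a set" where
  "Dih d b = Rot d \<union> ref ` {a. int d dvd a - b}"

context
  fixes d :: nat
  assumes d: "d dvd n"
begin

text \<open>An element determines its exponent only modulo \<open>n\<close>; since \<open>d\<close>
  divides \<open>n\<close>, divisibility by \<open>d\<close> does not depend on the chosen
  exponent.\<close>

lemma rot_in_Rot: "rot a \<in> Rot d \<longleftrightarrow> int d dvd a"
proof
  assume "rot a \<in> Rot d"
  then obtain b where "int d dvd b" "int n dvd a - b" by (auto simp: Rot_def rot_eq_iff)
  moreover have "int d dvd int n" using d by simp
  ultimately show "int d dvd a" by (metis dvd_trans dvd_add diff_add_cancel)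
qed (auto simp: Rot_def)

lemma ref_in_Rot: "ref a \<notin> Rot d"
  by (metis Rot_def imageE rot_neq_ref)

lemma rot_in_Dih: "rot a \<in> Dih d b \<longleftrightarrow> int d dvd a"
  using rot_in_Rot rot_neq_ref by (auto simp: Dih_def)

lemma ref_in_Dih: "ref a \<in> Dih d b \<longleftrightarrow> int d dvd a - b"
proof
  assume "ref a \<in> Dih d b"
  then obtain c where "int d dvd c - b" "int n dvd a - c"
    using ref_in_Rot by (auto simp: Dih_def ref_eq_iff)
  moreover have "int d dvd int n" using d by simp
  ultimately have "int d dvd (a - c) + (c - b)" by (metis dvd_trans dvd_add)
  then show "int d dvd a - b" by simp
qed (auto simp: Dih_def)

lemma Rot_subset: "Rot d \<subseteq> carrier G" and Dih_subset: "Dih d b \<subseteq> carrier G"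
  by (auto simp: Rot_def Dih_def)

lemma subgroup_Rot: "subgroup (Rot d) G"
proof (rule subgroupI)
  show "Rot d \<subseteq> carrier G" by (rule Rot_subset)
  show "Rot d \<noteq> {}" using rot_in_Rot[of 0] by auto
  show "inv x \<in> Rot d" if "x \<in> Rot d" for x
    using that by (auto simp: Rot_def inv_rot)
  show "x \<otimes> y \<in> Rot d" if "x \<in> Rot d" "y \<in> Rot d" for x y
    using that by (auto simp: Rot_def rot_rot)
qed

lemma subgroup_Dih: "subgroup (Dih d b) G"
proof (rule subgroupI)
  show "Dih d b \<subseteq> carrier G" by (rule Dih_subset)
  show "Dih d b \<noteq> {}" using rot_in_Dih[of 0] by auto
  show "inv x \<in> Dih d b" if "x \<in> Dih d b" for x
    using that by (auto simp: Dih_def Rot_def inv_rot inv_ref)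
  show "x \<otimes> y \<in> Dih d b" if "x \<in> Dih d b" "y \<in> Dih d b" for x y
  proof -
    have "x \<in> carrier G" using that(1) Dih_subset by blast
    then consider (rot) a where "x = rot a" | (ref) a where "x = ref a"
      by (auto simp: carrier_eq)
    note x = this
    have "y \<in> carrier G" using that(2) Dih_subset by blast
    then consider (rot) c where "y = rot c" | (ref) c where "y = ref c"
      by (auto simp: carrier_eq)
    note y = this
    show ?thesis
    proof (cases rule: x; cases rule: y)
      fix a c assume "x = rot a" "y = rot c"
      then show ?thesis using that by (simp add: rot_rot rot_in_Dih)
    next
      fix a c assume "x = rot a" "y = ref c"
      then show ?thesis using that dvd_add[of "int d" a "c - b"]
        by (simp add: rot_ref rot_in_Dih ref_in_Dih algebra_simps)
    next
      fix a c assume "x = ref a" "y = rot c"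
      then show ?thesis using that dvd_diff[of "int d" "a - b" c]
        by (simp add: ref_rot rot_in_Dih ref_in_Dih algebra_simps)
    next
      fix a c assume "x = ref a" "y = ref c"
      then show ?thesis using that dvd_diff[of "int d" "a - b" "c - b"]
        by (simp add: ref_ref rot_in_Dih ref_in_Dih)
    qed
  qed
qed

end

text \<open>The exponents of the rotations in \<open>H\<close> form an ideal of the integers,
  generated by its least positive element \<open>d\<close>. If \<open>H\<close> contains some
  reflection \<open>ref b\<close>, its reflections are exactly the products of its rotations with
  \<open>ref b\<close>.\<close>

lemma subgroup_cases:
  assumes "subgroup H G"
  obtains d where "d dvd n" "H = Rot d" | d b where "d dvd n" "H = Dih d b"
proof -
  interpret H: subgroup H G by fact
  define S where "S = {a. rot a \<in> H}"
  have zero: "0 \<in> S" by (simp add: S_def rot_0)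
  have add: "a + b \<in> S" if "a \<in> S" "b \<in> S" for a b
    using H.m_closed[of "rot a" "rot b"] that by (simp add: S_def rot_rot)
  have uminus: "- a \<in> S" if "a \<in> S" for a
    using H.m_inv_closed[of "rot a"] that by (simp add: S_def inv_rot)
  have mult_nat: "int k * a \<in> S" if "a \<in> S" for a k
    by (induction k) (auto simp: zero algebra_simps intro: add that)
  have mult: "k * a \<in> S" if "a \<in> S" for a k
    using mult_nat[OF that, of "nat k"] uminus[OF mult_nat[OF that, of "nat (- k)"]]
    by (cases "k \<ge> 0") auto
  \<comment> \<open>This provides a positive element for the minimum below, and later shows that
    \<open>d\<close> divides \<open>n\<close>.\<close>
  have nS: "int n \<in> S" by (simp add: S_def rot_eq_one_iff[THEN iffD2])
  define d where "d = (LEAST k. k > 0 \<and> int k \<in> S)"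
  have d: "d > 0" "int d \<in> S"
    using LeastI[of "\<lambda>k. k > 0 \<and> int k \<in> S" n] n_pos nS by (auto simp: d_def)
  have dvd: "int d dvd a" if "a \<in> S" for a
  proof (rule ccontr)
    assume "\<not> int d dvd a"
    then have pos: "nat (a mod int d) > 0"
      using d(1) by (simp add: dvd_eq_mod_eq_0) (smt (verit) of_nat_0_less_iff pos_mod_sign)
    \<comment> \<open>The remainder is a combination of elements of \<open>S\<close>, hence in
      \<open>S\<close>; being positive and less than \<open>d\<close>, it contradicts
      minimality.\<close>
    have "a mod int d = a + (- (a div int d)) * int d"
      by (simp add: minus_div_mult_eq_mod)
    then have "a mod int d \<in> S" using add[OF that mult[OF d(2)]] by metis
    then have "int (nat (a mod int d)) \<in> S" using pos by simp
    with pos have "d \<le> nat (a mod int d)" unfolding d_def by (intro Least_le) auto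
    moreover have "a mod int d < int d" using d(1) by simp
    ultimately show False using d(1) by (simp add: le_nat_iff)
  qed
  have S: "a \<in> S \<longleftrightarrow> int d dvd a" for a
    using dvd mult[OF d(2)] by (auto simp: dvd_def mult.commute)
  have dn: "d dvd n" using dvd[OF nS] by simp
  show thesis
  proof (cases "\<exists>b. ref b \<in> H")
    case True
    then obtain b where b: "ref b \<in> H" ..
    have "ref a \<in> H \<longleftrightarrow> int d dvd a - b" for a
    proof
      assume "ref a \<in> H"
      then have "rot (a - b) \<in> H" using H.m_closed[OF _ b] by (simp flip: ref_ref)
      then show "int d dvd a - b" using S by (simp add: S_def)
    next
      assume "int d dvd a - b"
      then have "rot (a - b) \<in> H" using S by (simp add: S_def)
      then show "ref a \<in> H" using H.m_closed[OF _ b] by (force simp: rot_ref)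
    qed
    then have "H = Dih d b"
      using S by (intro set_eqI H.subset Dih_subset dn)
        (simp_all add: S_def rot_in_Dih[OF dn] ref_in_Dih[OF dn])
    with dn show thesis by (rule that)
  next
    case False
    then have "H = Rot d"
      using S by (intro set_eqI H.subset Rot_subset dn)
        (simp_all add: S_def rot_in_Rot[OF dn] ref_in_Rot[OF dn])
    with dn show thesis by (rule that)
  qed
qed

text \<open>Turns adjacency into a condition on exponents: a reflection is never the identity, and a
  rotation is the identity only if \<open>n\<close> divides its exponent.\<close>

lemma Int_neq_one_iff:
  assumes "subgroup H G" "subgroup K G"
  shows "H \<inter> K \<noteq> {\<one>} \<longleftrightarrow>
    (\<exists>a. \<not> int n dvd a \<and> rot a \<in> H \<and> rot a \<in> K) \<or> (\<exists>a. ref a \<in> H \<and> ref a \<in> K)"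
proof -
  have "\<one> \<in> H \<inter> K" using assms by (simp add: subgroup.one_closed)
  then have "H \<inter> K \<noteq> {\<one>} \<longleftrightarrow> (\<exists>x\<in>H \<inter> K. x \<noteq> \<one>)" by blast
  also have "\<dots> \<longleftrightarrow> (\<exists>x\<in>carrier G. x \<in> H \<inter> K \<and> x \<noteq> \<one>)"
    using subgroup.subset[OF assms(1)] by blast
  also have "\<dots> \<longleftrightarrow> (\<exists>a. \<not> int n dvd a \<and> rot a \<in> H \<and> rot a \<in> K) \<or> (\<exists>a. ref a \<in> H \<and> ref a \<in> K)"
    by (auto simp: carrier_eq rot_eq_one_iff ref_neq_one)
  finally show ?thesis .
qed

text \<open>The reflection \<open>ref a\<close> lies in \<open>Dih d a\<close>, so equality forces
  the congruence. Hence residues modulo \<open>d\<close> index these subgroups without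
  repetition.\<close>

lemma Dih_eq_iff:
  assumes "d dvd n"
  shows "Dih d a = Dih d b \<longleftrightarrow> int d dvd a - b"
proof
  assume "Dih d a = Dih d b"
  then show "int d dvd a - b" using ref_in_Dih[OF assms, of a a] ref_in_Dih[OF assms, of a b] by simp
next
  assume ab: "int d dvd a - b"
  have "int d dvd c - a \<longleftrightarrow> int d dvd c - b" for c
    using dvd_add_left_iff[OF ab, of "c - a"] by simp
  then show "Dih d a = Dih d b"
    by (intro set_eqI Dih_subset) (simp_all add: assms rot_in_Dih ref_in_Dih)
qed

end

section \<open>The presented group is dihedral\<close>

text \<open>
  Words act on the elements \<open>r\<^sup>x s\<^sup>e\<close> of the infinite dihedral group by left multiplication. The
  action modulo \<open>n\<close> in the first coordinate respects the relations, so \<open>r\<close> has order exactly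
  \<open>n\<close> and \<open>s\<close> is not a power of \<open>r\<close>.
\<close>

fun word_act :: "dihedral_gen gword \<Rightarrow> int \<times> bool \<Rightarrow> int \<times> bool" where
  "word_act [] z = z"
| "word_act ((Gen_r, b) # w) z = (let (x, e) = word_act w z in (if b then x + 1 else x - 1, e))"
| "word_act ((Gen_s, b) # w) z = (let (x, e) = word_act w z in (- x, \<not> e))"

definition cong_act :: "nat \<Rightarrow> int \<times> bool \<Rightarrow> int \<times> bool \<Rightarrow> bool" where
  "cong_act n y z \<longleftrightarrow> int n dvd fst y - fst z \<and> snd y = snd z"

lemma cong_act_refl: "cong_act n z z"
  by (simp add: cong_act_def)

lemma cong_act_sym: "cong_act n y z \<Longrightarrow> cong_act n z y"
  by (simp add: cong_act_def dvd_diff_commute)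

lemma cong_act_trans: "cong_act n x y \<Longrightarrow> cong_act n y z \<Longrightarrow> cong_act n x z"
  using dvd_add[of "int n" "fst x - fst y" "fst y - fst z"] by (simp add: cong_act_def)

lemma word_act_append: "word_act (u @ v) z = word_act u (word_act v z)"
  by (induction u z rule: word_act.induct) auto

text \<open>Each letter shifts or negates the first coordinate, and both preserve congruence. This
  makes the congruence compatible with concatenation of words.\<close>

lemma word_act_cong:
  assumes "cong_act n y z"
  shows "cong_act n (word_act w y) (word_act w z)"
proof (induction w)
  case (Cons l w)
  obtain g b where l: "l = (g, b)" by (cases l)
  obtain x e x' e' where "word_act w y = (x, e)" "word_act w z = (x', e')"
    by (metis surj_pair)
  with Cons show ?case
    using dvd_diff_commute[of "int n" x x'] by (cases g) (simp_all add: l cong_act_def)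
qed (simp add: assms)

lemma word_act_replicate: "word_act (replicate k (Gen_r, True)) (x, e) = (x + int k, e)"
  by (induction k) auto

lemma gword_eq_imp_cong_act:
  assumes "gword_eq (dihedral_rels n) u v"
  shows "cong_act n (word_act u z) (word_act v z)"
  using assms
proof (induction arbitrary: z)
  case (relation u v)
  \<comment> \<open>The word r^n shifts \<open>x\<close> by \<open>n\<close>, the word ss acts
    trivially, and srs sends \<open>x\<close> to -(-x + 1) = x - 1, just as the inverse of r
    does.\<close>
  obtain x e where "z = (x, e)" by (cases z)
  with relation show ?case
    by (auto simp: dihedral_rels_def cong_act_def word_act_replicate)
next
  case (cancel g b)
  show ?case by (cases z; cases g) (auto simp: cong_act_def)
next
  case (append u u' v v')
  then show ?case
    unfolding word_act_append by (meson cong_act_trans word_act_cong)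
next
  case (refl u)
  show ?case by (rule cong_act_refl)
next
  case (sym u v)
  then show ?case by (intro cong_act_sym[OF sym.IH])
next
  case (trans u v w)
  show ?case by (rule cong_act_trans[OF trans.IH])
qed

text \<open>Conjugation by the involution \<open>y\<close> inverts \<open>x\<close> and therefore
  all its powers.\<close>

lemma (in group) inv_conj_int_pow:
  assumes "x \<in> carrier G" "y \<in> carrier G" "y \<otimes> y = \<one>" "y \<otimes> x \<otimes> y = inv x"
  shows "y \<otimes> x [^] (k::int) = x [^] (- k) \<otimes> y"
proof -
  have step: "y \<otimes> x = inv x \<otimes> y"
    by (metis assms inv_closed m_assoc m_closed r_one)
  have nat: "y \<otimes> x [^] m = inv x [^] m \<otimes> y" for m :: nat
  proof (induction m)
    case (Suc m)
    have "y \<otimes> x [^] Suc m = (y \<otimes> x [^] m) \<otimes> x" using assms by (simp add: m_assoc)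
    also have "\<dots> = inv x [^] m \<otimes> (y \<otimes> x)" using assms Suc by (simp add: m_assoc)
    also have "\<dots> = inv x [^] Suc m \<otimes> y" using assms by (simp add: step m_assoc)
    finally show ?case .
  qed (use assms in simp)
  have inv_nat: "x [^] m \<otimes> y = y \<otimes> inv x [^] m" for m :: nat
  proof -
    \<comment> \<open>Multiplying the identity for natural exponents by \<open>y\<close> on both
      sides exchanges \<open>x\<close> and its inverse, which covers the negative exponents.\<close>
    have "y \<otimes> (y \<otimes> x [^] m) \<otimes> y = y \<otimes> (inv x [^] m \<otimes> y) \<otimes> y" by (simp add: nat)
    then have "x [^] m \<otimes> y = y \<otimes> inv x [^] m"
      using assms by (simp add: m_assoc[symmetric]) (simp add: m_assoc)
    then show ?thesis .
  qed
  show ?thesis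
  proof (cases k rule: int_cases2)
    case (nonneg m)
    then show ?thesis using nat[of m] assms by (simp add: int_pow_neg int_pow_int nat_pow_inv)
  next
    case (nonpos m)
    then show ?thesis using inv_nat[of m] assms by (simp add: int_pow_neg int_pow_int nat_pow_inv)
  qed
qed

text \<open>The defining relations give the product rules and show that every word equals some r^a
  or r^a s; the action on pairs shows that these elements do not collapse further.\<close>

lemma dihedral_dihedral_group:
  assumes "n > 0"
  obtains rot ref where "dihedral (dihedral_group n) rot ref n"
proof -
  define G where "G = dihedral_group n"
  interpret group G
    unfolding G_def dihedral_group_def by (rule group_presented_group)
  define cls where "cls w = gword_rel (dihedral_rels n) `` {w}" for w
  have cls_mult: "cls u \<otimes>\<^bsub>G\<^esub> cls v = cls (u @ v)" for u v
    unfolding G_def dihedral_group_def cls_def by (rule presented_group_mult)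
  have cls_one: "\<one>\<^bsub>G\<^esub> = cls []"
    by (simp add: G_def dihedral_group_def presented_group_def cls_def)
  have carr: "carrier G = range cls"
    by (auto simp: G_def dihedral_group_def presented_group_def cls_def quotient_def)
  have cls_eq: "cls u = cls v \<longleftrightarrow> gword_eq (dihedral_rels n) u v" for u v
    using eq_equiv_class_iff[OF equiv_gword_rel, of u v "dihedral_rels n"]
    by (simp add: cls_def gword_rel_def)
  define r s where "r = cls [(Gen_r, True)]" and "s = cls [(Gen_s, True)]"
  have rs [simp]: "r \<in> carrier G" "s \<in> carrier G" by (auto simp: carr r_def s_def)
  have r_pow: "r [^]\<^bsub>G\<^esub> k = cls (replicate k (Gen_r, True))" for k :: nat
    by (induction k) (auto simp: cls_one cls_mult r_def replicate_append_same)
  have ss: "s \<otimes>\<^bsub>G\<^esub> s = \<one>\<^bsub>G\<^esub>"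
    by (auto simp: s_def cls_mult cls_one cls_eq dihedral_rels_def intro: gword_eq.relation)
  have inv_r: "inv\<^bsub>G\<^esub> r = cls [(Gen_r, False)]"
    using gword_eq.cancel[of _ Gen_r False]
    by (intro inv_equality) (auto simp: r_def carr cls_mult cls_one cls_eq)
  \<comment> \<open>As s is an involution, its formal inverse letter has the same class.\<close>
  have inv_s: "cls [(Gen_s, b)] = s" for b
  proof (cases b)
    case False
    have "inv\<^bsub>G\<^esub> s = cls [(Gen_s, False)]"
      using gword_eq.cancel[of _ Gen_s False]
      by (intro inv_equality) (auto simp: s_def carr cls_mult cls_one cls_eq)
    moreover have "inv\<^bsub>G\<^esub> s = s" by (rule inv_equality) (simp_all add: ss)
    ultimately show ?thesis using False by simp
  qed (simp add: s_def)
  have srs: "s \<otimes>\<^bsub>G\<^esub> r \<otimes>\<^bsub>G\<^esub> s = inv\<^bsub>G\<^esub> r"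
    unfolding inv_r
    by (auto simp: r_def s_def cls_mult cls_eq dihedral_rels_def intro: gword_eq.relation)
  have act: "cong_act n (word_act u (0, False)) (word_act v (0, False))" if "cls u = cls v" for u v
    using that by (simp add: cls_eq gword_eq_imp_cong_act)
  \<comment> \<open>For the forward direction, the k-th power of r moves \<open>(0, False)\<close>
    to \<open>(k, False)\<close>, which must agree with the start modulo \<open>n\<close>.\<close>
  have r_pow_one: "r [^]\<^bsub>G\<^esub> k = \<one>\<^bsub>G\<^esub> \<longleftrightarrow> n dvd k" for k :: nat
  proof
    assume "r [^]\<^bsub>G\<^esub> k = \<one>\<^bsub>G\<^esub>"
    then show "n dvd k"
      using act[of "replicate k (Gen_r, True)" "[]"]
      by (simp add: r_pow cls_one word_act_replicate cong_act_def)
  next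
    have "r [^]\<^bsub>G\<^esub> n = \<one>\<^bsub>G\<^esub>"
      by (auto simp: r_pow cls_one cls_eq dihedral_rels_def intro: gword_eq.relation)
    moreover assume "n dvd k"
    then obtain m where "k = n * m" ..
    ultimately show "r [^]\<^bsub>G\<^esub> k = \<one>\<^bsub>G\<^esub>"
      using nat_pow_pow[OF rs(1), of n m] by simp
  qed
  then have ord: "ord r = n"
    using ord_unique[OF rs(1)] by blast
  define rot ref where "rot a = r [^]\<^bsub>G\<^esub> a" and "ref a = rot a \<otimes>\<^bsub>G\<^esub> s" for a :: int
  have rot_closed [simp]: "rot a \<in> carrier G" for a by (simp add: rot_def)
  have rot_rot: "rot a \<otimes>\<^bsub>G\<^esub> rot b = rot (a + b)" for a b
    by (simp add: rot_def int_pow_mult)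
  have s_rot: "s \<otimes>\<^bsub>G\<^esub> rot b = rot (- b) \<otimes>\<^bsub>G\<^esub> s" for b
    unfolding rot_def by (rule inv_conj_int_pow) (simp_all add: ss srs)
  have rot_eq: "rot a = rot b \<longleftrightarrow> int n dvd a - b" for a b
    using int_pow_eq[OF rs(1), of a b] by (simp add: rot_def ord dvd_diff_commute)
  have rot_ref: "rot a \<otimes>\<^bsub>G\<^esub> ref b = ref (a + b)" for a b
    by (simp add: ref_def rot_rot flip: m_assoc)
  have ref_rot: "ref a \<otimes>\<^bsub>G\<^esub> rot b = ref (a - b)" for a b
  proof -
    have "ref a \<otimes>\<^bsub>G\<^esub> rot b = rot a \<otimes>\<^bsub>G\<^esub> (s \<otimes>\<^bsub>G\<^esub> rot b)" by (simp add: ref_def m_assoc)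
    also have "\<dots> = (rot a \<otimes>\<^bsub>G\<^esub> rot (- b)) \<otimes>\<^bsub>G\<^esub> s" by (simp add: s_rot m_assoc)
    finally show ?thesis by (simp add: rot_rot ref_def)
  qed
  have ref_ref: "ref a \<otimes>\<^bsub>G\<^esub> ref b = rot (a - b)" for a b
  proof -
    have "ref a \<otimes>\<^bsub>G\<^esub> ref b = (ref a \<otimes>\<^bsub>G\<^esub> rot b) \<otimes>\<^bsub>G\<^esub> s"
      by (simp add: ref_def m_assoc)
    also have "\<dots> = rot (a - b) \<otimes>\<^bsub>G\<^esub> (s \<otimes>\<^bsub>G\<^esub> s)" by (simp only: ref_rot) (simp add: ref_def m_assoc)
    finally show ?thesis by (simp add: ss)
  qed
  have rot_1: "rot 1 = r" and rot_m1: "rot (- 1) = inv\<^bsub>G\<^esub> r" and rot_0: "rot 0 = \<one>\<^bsub>G\<^esub>"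
    by (simp_all add: rot_def int_pow_neg)
  have ref_0: "ref 0 = s" by (simp add: ref_def rot_0)
  \<comment> \<open>The rotations and reflections are closed under left multiplication by the class
    of any letter.\<close>
  have gen: "cls w \<in> range rot \<union> range ref" for w
  proof (induction w)
    case Nil
    then show ?case using rot_0 by (metis UnI1 cls_one rangeI)
  next
    case (Cons l w)
    obtain g b where l: "l = (g, b)" by (cases l)
    have "cls [l] \<in> {rot 1, rot (- 1), ref 0}"
      by (cases g; cases b) (simp_all add: l rot_1 rot_m1 ref_0 inv_s flip: r_def inv_r)
    moreover have "cls (l # w) = cls [l] \<otimes>\<^bsub>G\<^esub> cls w" by (simp add: cls_mult)
    ultimately show ?case
      using Cons by (auto simp: rot_rot rot_ref ref_rot ref_ref simp del: rot_closed)
  qed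
  have s_not_rot: "rot a \<noteq> s" for a
  proof
    assume "rot a = s"
    \<comment> \<open>A non-negative exponent is needed to write the rotation as a word in r alone.
      Such a word keeps the Boolean coordinate, whereas s flips it.\<close>
    moreover have "rot a = rot (int (nat (a mod int n)))"
      using assms by (simp add: rot_eq minus_mod_eq_mult_div)
    ultimately have "cls (replicate (nat (a mod int n)) (Gen_r, True)) = cls [(Gen_s, True)]"
      by (simp only: rot_def int_pow_int r_pow s_def)
    from act[OF this] show False
      by (simp add: word_act_replicate cong_act_def)
  qed
  have "dihedral G rot ref n"
  proof (intro dihedral.intro dihedral_axioms.intro)
    show "carrier G = range rot \<union> range ref"
    proof
      show "carrier G \<subseteq> range rot \<union> range ref"
        using gen unfolding carr by blast
    qed (auto simp: ref_def)
    show "ref a = ref b \<longleftrightarrow> int n dvd a - b" for a b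
      by (simp add: ref_def flip: rot_eq)
    show "rot a \<noteq> ref b" for a b
    proof
      assume "rot a = ref b"
      \<comment> \<open>Cancelling r^b would make s a rotation.\<close>
      then have "rot (- b) \<otimes>\<^bsub>G\<^esub> rot a = rot (- b) \<otimes>\<^bsub>G\<^esub> ref b" by simp
      then show False using s_not_rot by (simp add: rot_rot rot_ref ref_0)
    qed
  qed (fact is_group assms rot_0 rot_rot rot_ref ref_rot ref_ref rot_eq)+
  then show thesis unfolding G_def by (rule that)
qed

section \<open>The intersection graph of the dihedral group of order \<open>2p\<^sup>2\<close>\<close>

lemma int_dvd_diff_iff: "int m dvd int i - int j \<longleftrightarrow> i mod m = j mod m"
  by (metis mod_eq_dvd_iff of_nat_eq_iff of_nat_mod)

text \<open>Each residue class modulo \<open>p\<close> has exactly \<open>p\<close> members below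
  p^2, namely i + p k for k < p.\<close>

lemma sum_if_mod:
  fixes a b :: real
  assumes "i < p"
  shows "(\<Sum>j<p\<^sup>2. if j mod p = i then a else b) = real p * a + (real p ^ 2 - real p) * b"
proof -
  have "{j. j < p\<^sup>2 \<and> j mod p = i} = (\<lambda>k. i + p * k) ` {..<p}"
  proof (intro equalityI subsetI)
    fix j assume j: "j \<in> {j. j < p\<^sup>2 \<and> j mod p = i}"
    then have "j div p < p"
      by (auto simp: power2_eq_square less_mult_imp_div_less)
    moreover have "j = i + p * (j div p)" using j by auto
    ultimately show "j \<in> (\<lambda>k. i + p * k) ` {..<p}" by blast
  next
    fix j assume "j \<in> (\<lambda>k. i + p * k) ` {..<p}"
    then obtain k where k: "j = i + p * k" "k < p" by auto
    have "i + p * k < p * Suc k" using assms by simp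
    also have "\<dots> \<le> p * p" using k(2) by (intro mult_le_mono2) simp
    finally show "j \<in> {j. j < p\<^sup>2 \<and> j mod p = i}"
      using assms k(1) by (simp add: power2_eq_square)
  qed
  moreover have "inj_on (\<lambda>k. i + p * k) {..<p}"
    using assms by (auto simp: inj_on_def)
  ultimately have card: "card {j. j < p\<^sup>2 \<and> j mod p = i} = p"
    by (simp add: card_image)
  have "(\<Sum>j<p\<^sup>2. if j mod p = i then a else b) =
      (\<Sum>j<p\<^sup>2. b + (if j mod p = i then a - b else 0))"
    by (rule sum.cong) auto
  also have "\<dots> = real (p\<^sup>2) * b + (\<Sum>j\<in>{j\<in>{..<p\<^sup>2}. j mod p = i}. a - b)"
    by (simp only: sum.distrib sum.inter_filter[OF finite_lessThan]) simp
  also have "\<dots> = real (p\<^sup>2) * b + real p * (a - b)"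
    using card by simp
  finally show ?thesis by (simp add: algebra_simps)
qed

context dihedral
begin

lemma parcs_iff:
  "(H, K) \<in> parcs (intersection_graph G) \<longleftrightarrow>
    H \<in> pverts (intersection_graph G) \<and> K \<in> pverts (intersection_graph G) \<and> H \<noteq> K \<and>
    ((\<exists>a. \<not> int n dvd a \<and> rot a \<in> H \<and> rot a \<in> K) \<or> (\<exists>a. ref a \<in> H \<and> ref a \<in> K))"
  using Int_neq_one_iff[of H K] by (auto simp: intersection_graph_def Let_def)

lemma pverts_iff:
  "H \<in> pverts (intersection_graph G) \<longleftrightarrow> subgroup H G \<and> H \<noteq> carrier G \<and> H \<noteq> {\<one>}"
  by (simp add: intersection_graph_def Let_def)

lemma parcs_sym:
  "(H, K) \<in> parcs (intersection_graph G) \<longleftrightarrow> (K, H) \<in> parcs (intersection_graph G)"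
  by (auto simp: parcs_iff)

context
  fixes p :: nat
  assumes prime: "Factorial_Ring.prime p" and n: "n = p ^ 2"
begin

declare One_nat_def [simp del]

abbreviation \<Gamma> where "\<Gamma> \<equiv> intersection_graph G"

abbreviation big :: "nat \<Rightarrow> 'a set" where "big i \<equiv> Dih p (int i)"

abbreviation small :: "nat \<Rightarrow> 'a set" where "small j \<equiv> Dih n (int j)"

lemma p_gt_1: "p > 1" and p_dvd_n: "p dvd n" and not_n_dvd_p: "\<not> n dvd p"
  and not_n_dvd_1: "\<not> int n dvd 1" and not_p_dvd_1: "\<not> int p dvd 1"
  and real_n: "real n = real p ^ 2"
proof -
  show *: "p > 1" using prime by (rule prime_gt_1_nat)
  then show "p dvd n" and **: "\<not> n dvd p"
    by (auto simp: n power2_eq_square dest: dvd_imp_le)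
  from ** have "n \<noteq> 1" by auto
  with * show "\<not> int n dvd 1" "\<not> int p dvd 1" by simp_all
  show "real n = real p ^ 2" by (simp add: n)
qed

lemma dvd_n_cases: "d dvd n \<Longrightarrow> d = 1 \<or> d = p \<or> d = n"
proof -
  assume "d dvd n"
  then obtain i where "i \<le> 2" "d = p ^ i"
    using divides_primepow_nat[OF prime, of d 2] by (auto simp: n)
  then show ?thesis by (auto simp: n le_Suc_eq numeral_2_eq_2)
qed

lemmas mem_simps =
  rot_in_Rot[OF one_dvd] rot_in_Rot[OF p_dvd_n]
  ref_in_Rot[OF one_dvd] ref_in_Rot[OF p_dvd_n]
  rot_in_Dih[OF p_dvd_n] rot_in_Dih[OF dvd_refl] ref_in_Dih[OF p_dvd_n] ref_in_Dih[OF dvd_refl]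

lemma Rot_n: "Rot n = {\<one>}"
  by (rule set_eqI[OF Rot_subset])
    (auto simp: rot_in_Rot ref_in_Rot rot_eq_one_iff ref_neq_one)

lemma Dih_1: "Dih 1 b = carrier G"
  by (rule set_eqI[OF Dih_subset]) (auto simp: rot_in_Dih ref_in_Dih)

lemma Dih_nat: "0 < d \<Longrightarrow> d dvd n \<Longrightarrow> Dih d b = Dih d (int (nat (b mod int d)))"
  by (simp add: Dih_eq_iff minus_mod_eq_mult_div)

section \<open>The vertices of the graph\<close>

lemma Rot_in_pverts: "Rot 1 \<in> pverts \<Gamma>" "Rot p \<in> pverts \<Gamma>"
proof -
  have "rot (int p) \<noteq> \<one>" using not_n_dvd_p by (simp add: rot_eq_one_iff)
  moreover have "rot (int p) \<in> Rot 1" "rot (int p) \<in> Rot p" by (simp_all add: mem_simps)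
  moreover have "ref 0 \<notin> Rot 1" "ref 0 \<notin> Rot p" by (simp_all add: mem_simps)
  ultimately show "Rot 1 \<in> pverts \<Gamma>" "Rot p \<in> pverts \<Gamma>"
    using ref_closed[of 0] subgroup_Rot[OF one_dvd] subgroup_Rot[OF p_dvd_n]
    unfolding pverts_iff by blast+
qed

lemma Dih_in_pverts: "Dih p b \<in> pverts \<Gamma>" "Dih n b \<in> pverts \<Gamma>"
proof -
  have "ref b \<in> Dih p b" "ref b \<in> Dih n b" by (simp_all add: mem_simps)
  moreover have "rot 1 \<notin> Dih p b" "rot 1 \<notin> Dih n b"
    using not_n_dvd_1 not_p_dvd_1 by (simp_all add: mem_simps)
  ultimately show "Dih p b \<in> pverts \<Gamma>" "Dih n b \<in> pverts \<Gamma>"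
    using rot_closed[of 1] ref_neq_one[of b] subgroup_Dih[OF dvd_refl] subgroup_Dih[OF p_dvd_n]
    unfolding pverts_iff by blast+
qed

text \<open>The divisors of p^2 are 1, p and p^2. Of the resulting subgroups, \<open>Rot n\<close>
  is trivial and \<open>Dih 1 b\<close> is the whole group; in the others \<open>b\<close> may be
  reduced modulo \<open>d\<close>.\<close>

lemma pverts_eq: "pverts \<Gamma> = {Rot 1, Rot p} \<union> big ` {..<p} \<union> small ` {..<n}"
proof (intro equalityI subsetI)
  fix H assume H: "H \<in> pverts \<Gamma>"
  then have "subgroup H G" by (simp add: pverts_iff)
  then show "H \<in> {Rot 1, Rot p} \<union> big ` {..<p} \<union> small ` {..<n}"
  proof (cases rule: subgroup_cases)
    case (1 d)
    then have "d \<noteq> n" using H Rot_n by (auto simp: pverts_iff)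
    then show ?thesis using 1 dvd_n_cases by auto
  next
    case (2 d b)
    then have "d = p \<or> d = n" using H dvd_n_cases Dih_1 by (auto simp: pverts_iff)
    moreover from this have "d > 0" using n_pos p_gt_1 by auto
    then have "nat (b mod int d) < d" "H = Dih d (int (nat (b mod int d)))"
      using 2 Dih_nat[of d b] by (simp_all add: nat_less_iff)
    ultimately show ?thesis by blast
  qed
qed (use Rot_in_pverts Dih_in_pverts in auto)

lemma pverts_cases:
  assumes "H \<in> pverts \<Gamma>"
  obtains "H = Rot 1" | "H = Rot p" | i where "i < p" "H = big i" | j where "j < n" "H = small j"
  using assms unfolding pverts_eq by blast

lemma Rot_1_neq_Rot_p: "Rot 1 \<noteq> Rot p"
  using not_p_dvd_1 mem_simps(1,2)[of 1] by auto

lemma Rot_neq_Dih: "Rot 1 \<noteq> Dih p b" "Rot p \<noteq> Dih p b" "Rot 1 \<noteq> Dih n b" "Rot p \<noteq> Dih n b"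
  using mem_simps(3,4)[of b] mem_simps(7,8)[of b b] by auto

lemma big_neq_small: "Dih p a \<noteq> Dih n b"
  using not_n_dvd_p mem_simps(5)[of "int p" a] mem_simps(6)[of "int p" b] by auto

lemma big_eq_iff: "big i = big j \<longleftrightarrow> i mod p = j mod p"
  and small_eq_iff: "small i = small j \<longleftrightarrow> i mod n = j mod n"
  by (simp_all add: Dih_eq_iff p_dvd_n int_dvd_diff_iff)

lemma sum_pverts:
  fixes f :: "'a set \<Rightarrow> real"
  shows "(\<Sum>H\<in>pverts \<Gamma>. f H) =
    f (Rot 1) + f (Rot p) + (\<Sum>i<p. f (big i)) + (\<Sum>j<n. f (small j))"
proof -
  have inj: "inj_on big {..<p}" "inj_on small {..<n}"
    by (simp_all add: inj_on_def big_eq_iff small_eq_iff)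
  have disj: "{Rot 1, Rot p} \<inter> big ` {..<p} = {}"
    "({Rot 1, Rot p} \<union> big ` {..<p}) \<inter> small ` {..<n} = {}"
    using Rot_neq_Dih big_neq_small by blast+
  have "(\<Sum>H\<in>pverts \<Gamma>. f H) =
      sum f {Rot 1, Rot p} + sum f (big ` {..<p}) + sum f (small ` {..<n})"
    unfolding pverts_eq by (simp add: sum.union_disjoint disj del: Un_insert_left)
  then show ?thesis
    using Rot_1_neq_Rot_p by (simp add: sum.reindex inj)
qed

section \<open>Adjacency and distances\<close>

lemma parcs_rot_p:
  assumes "H \<in> pverts \<Gamma>" "K \<in> pverts \<Gamma>" "H \<noteq> K" "rot (int p) \<in> H" "rot (int p) \<in> K"
  shows "(H, K) \<in> parcs \<Gamma>"
  using assms not_n_dvd_p unfolding parcs_iff by (metis int_dvd_int_iff)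

text \<open>The only non-trivial element of \<open>small j\<close> is \<open>ref (int j)\<close>, so
  any non-trivial intersection must contain it.\<close>

lemma small_parcs_iff:
  "(small j, K) \<in> parcs \<Gamma> \<longleftrightarrow> K \<in> pverts \<Gamma> \<and> K \<noteq> small j \<and> ref (int j) \<in> K"
proof -
  have "rot a \<in> small j \<longleftrightarrow> int n dvd a" "ref a \<in> small j \<longleftrightarrow> ref a = ref (int j)" for a
    by (simp_all add: mem_simps ref_eq_iff)
  moreover have "(\<exists>a. ref a = ref (int j) \<and> ref a \<in> K) \<longleftrightarrow> ref (int j) \<in> K"
    by metis
  ultimately show ?thesis
    unfolding parcs_iff using Dih_in_pverts(2) by auto
qed

text \<open>A walk-free candidate for the distance, with 3 as the default value. That 3 is the true
  distance in the remaining case is shown in \<open>graph_dist_eq_dst\<close>.\<close>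

definition dst :: "'a set \<Rightarrow> 'a set \<Rightarrow> real" where
  "dst H K = (if H = K then 0 else if (H, K) \<in> parcs \<Gamma> then 1
    else if \<exists>L. (H, L) \<in> parcs \<Gamma> \<and> (L, K) \<in> parcs \<Gamma> then 2 else 3)"

lemma dst_sym: "dst H K = dst K H"
proof -
  have "(\<exists>L. (H, L) \<in> parcs \<Gamma> \<and> (L, K) \<in> parcs \<Gamma>) \<longleftrightarrow>
      (\<exists>L. (K, L) \<in> parcs \<Gamma> \<and> (L, H) \<in> parcs \<Gamma>)"
    using parcs_sym by blast
  then show ?thesis
    unfolding dst_def parcs_sym[of H K] by (simp add: eq_commute[of H K])
qed

lemma dst_rot_p:
  assumes "H \<in> pverts \<Gamma>" "K \<in> pverts \<Gamma>" "rot (int p) \<in> H" "rot (int p) \<in> K"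
  shows "dst H K = (if H = K then 0 else 1)"
  using parcs_rot_p[OF assms(1,2)] assms(3,4) by (simp add: dst_def)

lemma small_big_parcs: "(small j, big (j mod p)) \<in> parcs \<Gamma>"
  unfolding small_parcs_iff
  using Dih_in_pverts big_neq_small by (simp add: mem_simps int_dvd_diff_iff del: of_nat_mod)

text \<open>If \<open>H\<close> misses the reflection of \<open>small j\<close>, then
  \<open>big (j mod p)\<close> is a common neighbour: it contains that reflection and shares r^p
  with \<open>H\<close>.\<close>

lemma dst_small_rot_p:
  assumes H: "H \<in> pverts \<Gamma>" "rot (int p) \<in> H"
  shows "dst (small j) H = (if ref (int j) \<in> H then 1 else 2)"
proof -
  have neq: "H \<noteq> small j" using H(2) not_n_dvd_p by (auto simp: mem_simps)
  have arc: "(small j, H) \<in> parcs \<Gamma> \<longleftrightarrow> ref (int j) \<in> H"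
    using H neq by (simp add: small_parcs_iff)
  moreover have "(big (j mod p), H) \<in> parcs \<Gamma>" if "ref (int j) \<notin> H"
  proof (rule parcs_rot_p)
    show "big (j mod p) \<noteq> H"
      using that arc small_big_parcs by auto
  qed (use H Dih_in_pverts in \<open>auto simp: mem_simps\<close>)
  ultimately show ?thesis
    using neq small_big_parcs[of j] unfolding dst_def by auto
qed

text \<open>A common neighbour contains both reflections. Rotation groups contain none and another
  group of order 2 cannot contain \<open>ref (int j)\<close>, so it is some \<open>big i\<close>
  with j and k both congruent to i modulo \<open>p\<close>.\<close>

lemma dst_small_small:
  "dst (small j) (small k) =
    (if small j = small k then 0 else if j mod p = k mod p then 2 else 3)"
proof -
  have "(small j, small k) \<notin> parcs \<Gamma>"
  proof
    assume "(small j, small k) \<in> parcs \<Gamma>"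
    then show False
      by (auto simp: small_parcs_iff mem_simps Dih_eq_iff dvd_diff_commute)
  qed
  moreover have "(\<exists>L. (small j, L) \<in> parcs \<Gamma> \<and> (L, small k) \<in> parcs \<Gamma>) \<longleftrightarrow> j mod p = k mod p"
    if "small j \<noteq> small k"
  proof
    assume "\<exists>L. (small j, L) \<in> parcs \<Gamma> \<and> (L, small k) \<in> parcs \<Gamma>"
    then obtain L where L: "L \<in> pverts \<Gamma>" "ref (int j) \<in> L" "ref (int k) \<in> L"
      "L \<noteq> small j"
      using parcs_sym small_parcs_iff by metis
    from L(1) show "j mod p = k mod p"
    proof (cases rule: pverts_cases)
      case (3 i)
      with L show ?thesis by (simp add: mem_simps int_dvd_diff_iff)
    next
      case (4 l)
      with L show ?thesis by (simp add: mem_simps Dih_eq_iff dvd_diff_commute)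
    qed (use L in \<open>simp_all add: mem_simps\<close>)
  next
    assume "j mod p = k mod p"
    then show "\<exists>L. (small j, L) \<in> parcs \<Gamma> \<and> (L, small k) \<in> parcs \<Gamma>"
      using small_big_parcs parcs_sym by metis
  qed
  ultimately show ?thesis by (simp add: dst_def)
qed

lemma rot_p_or_small:
  assumes "H \<in> pverts \<Gamma>"
  obtains "rot (int p) \<in> H" | j where "H = small j"
  using assms by (cases rule: pverts_cases) (auto simp: mem_simps)

text \<open>The values 1 and 2 are immediate from arcs and common neighbours; the default value
  requires a walk of length 3.\<close>

lemma graph_dist_eq_dst:
  assumes H: "H \<in> pverts \<Gamma>" and K: "K \<in> pverts \<Gamma>" and neq: "H \<noteq> K"
  shows "graph_dist \<Gamma> H K = ereal (dst H K)"
proof -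
  interpret pair_graph \<Gamma>
    by (rule pair_graph_intersection_graph[OF finite_carrier])
  consider "(H, K) \<in> parcs \<Gamma>"
    | L where "(H, K) \<notin> parcs \<Gamma>" "(H, L) \<in> parcs \<Gamma>" "(L, K) \<in> parcs \<Gamma>"
    | "(H, K) \<notin> parcs \<Gamma>" "\<And>L. (H, L) \<in> parcs \<Gamma> \<Longrightarrow> (L, K) \<notin> parcs \<Gamma>"
    by blast
  then show ?thesis
  proof cases
    case 1
    then show ?thesis using neq by (simp add: graph_dist_eq_1 dst_def)
  next
    case 2
    then show ?thesis using neq graph_dist_eq_2[of H L K] by (auto simp: dst_def)
  next
    case 3
    then have dst: "dst H K = 3" using neq by (auto simp: dst_def)
    \<comment> \<open>A vertex containing r^p has \<open>dst\<close> at most 2 to every vertex, so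
      both ends must be of order 2.\<close>
    have "\<exists>j. H = small j"
      using H dst dst_rot_p[OF H K] dst_small_rot_p[OF H] neq
      by (cases rule: rot_p_or_small[OF H]; cases rule: rot_p_or_small[OF K])
        (auto simp: dst_sym[of H] split: if_splits)
    moreover have "\<exists>k. K = small k"
      using dst dst_rot_p[OF H K] dst_small_rot_p[OF K] neq
      by (cases rule: rot_p_or_small[OF H]; cases rule: rot_p_or_small[OF K])
        (auto split: if_splits)
    ultimately obtain j k where jk: "H = small j" "K = small k" by blast
    have "j mod p \<noteq> k mod p" using dst by (auto simp: jk dst_small_small split: if_splits)
    \<comment> \<open>These two distinct groups share r^p, which supplies the middle arc of the
      walk.\<close>
    then have "big (j mod p) \<noteq> big (k mod p)" by (simp add: big_eq_iff)
    then have "(big (j mod p), big (k mod p)) \<in> parcs \<Gamma>"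
      by (intro parcs_rot_p Dih_in_pverts) (simp_all add: mem_simps)
    then have "graph_dist \<Gamma> H K = ereal 3"
      using small_big_parcs parcs_sym 3 neq unfolding jk
      by (intro graph_dist_eq_3[of _ "big (j mod p)" "big (k mod p)"]) auto
    then show ?thesis by (simp add: dst)
  qed
qed

lemma dst_Rot_Rot:
  "dst (Rot 1) (Rot 1) = 0" "dst (Rot 1) (Rot p) = 1"
  "dst (Rot p) (Rot 1) = 1" "dst (Rot p) (Rot p) = 0"
  using Rot_in_pverts Rot_1_neq_Rot_p by (auto simp: dst_rot_p mem_simps)

lemma dst_Rot_big: "dst (Rot 1) (big i) = 1" "dst (Rot p) (big i) = 1"
  using Rot_in_pverts Dih_in_pverts Rot_neq_Dih by (simp_all add: dst_rot_p mem_simps)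

lemma dst_small_Rot: "dst (small j) (Rot 1) = 2" "dst (small j) (Rot p) = 2"
  using Rot_in_pverts by (simp_all add: dst_small_rot_p mem_simps)

lemmas dst_values = dst_Rot_Rot dst_Rot_big dst_small_Rot
  dst_Rot_big[THEN HOL.trans[OF dst_sym]] dst_small_Rot[THEN HOL.trans[OF dst_sym]]

lemma dst_big_big: "i < p \<Longrightarrow> k < p \<Longrightarrow> dst (big i) (big k) = (if i = k then 0 else 1)"
  using Dih_in_pverts by (simp add: dst_rot_p mem_simps big_eq_iff)

lemma dst_small_big: "i < p \<Longrightarrow> dst (small j) (big i) = (if j mod p = i then 1 else 2)"
  using Dih_in_pverts by (simp add: dst_small_rot_p mem_simps int_dvd_diff_iff)

section \<open>Row sums of the distance and the Wiener index\<close>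

lemma sum_dst_Rot:
  "(\<Sum>K\<in>pverts \<Gamma>. dst (Rot 1) K) = 1 + real p + 2 * real p ^ 2"
  "(\<Sum>K\<in>pverts \<Gamma>. dst (Rot p) K) = 1 + real p + 2 * real p ^ 2"
  unfolding sum_pverts by (simp_all add: dst_values real_n)

text \<open>The rotation groups contribute 2, the other groups of order 2p contribute p - 1. Of the
  groups of order 2, p are adjacent and the other p^2 - p are at distance 2.\<close>

lemma sum_dst_big:
  assumes "i < p"
  shows "(\<Sum>K\<in>pverts \<Gamma>. dst (big i) K) = 1 + 2 * real p ^ 2"
proof -
  have "(\<Sum>k<p. dst (big i) (big k)) = (\<Sum>k<p. 1 - (if i = k then 1 else 0))"
    by (rule sum.cong) (use assms in \<open>auto simp: dst_big_big\<close>)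
  also have "\<dots> = real p - 1"
    using assms by (simp add: sum_subtractf)
  finally have 1: "(\<Sum>k<p. dst (big i) (big k)) = real p - 1" .
  have "(\<Sum>j<n. dst (big i) (small j)) = (\<Sum>j<n. if j mod p = i then 1 else 2)"
    by (rule sum.cong) (use assms in \<open>auto simp: dst_sym[of "big i"] dst_small_big\<close>)
  then have 2: "(\<Sum>j<n. dst (big i) (small j)) = 2 * real p ^ 2 - real p"
    using sum_if_mod[OF assms, of 1 2, folded n] by simp
  show ?thesis unfolding sum_pverts 1 2 dst_values by simp
qed

lemma sum_dst_small:
  assumes "j < n"
  shows "(\<Sum>K\<in>pverts \<Gamma>. dst (small j) K) = 3 * real p ^ 2 + real p + 1"
proof -
  have jp: "j mod p < p" using p_gt_1 by simp
  have "(\<Sum>i<p. dst (small j) (big i)) = (\<Sum>i<p. 2 - (if j mod p = i then 1 else 0))"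
    by (rule sum.cong) (auto simp: dst_small_big)
  also have "\<dots> = 2 * real p - 1"
    using jp by (simp add: sum_subtractf)
  finally have 1: "(\<Sum>i<p. dst (small j) (big i)) = 2 * real p - 1" .
  \<comment> \<open>Every k in the residue class of j counts 2, including k = j itself, whose true
    value 0 is restored by the correction term.\<close>
  have "(\<Sum>k<n. dst (small j) (small k)) =
      (\<Sum>k<n. (if k mod p = j mod p then 2 else 3) - (if j = k then 2 else 0))"
    by (rule sum.cong) (use assms in \<open>auto simp: dst_small_small small_eq_iff\<close>)
  also have "\<dots> = (\<Sum>k<n. if k mod p = j mod p then 2 else 3) - 2"
    using assms by (simp add: sum_subtractf)
  also have "\<dots> = 3 * real p ^ 2 - real p - 2"
    using sum_if_mod[OF jp, of 2 3, folded n] by simp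
  finally have 2: "(\<Sum>k<n. dst (small j) (small k)) = 3 * real p ^ 2 - real p - 2" .
  show ?thesis unfolding sum_pverts 1 2 dst_values by simp
qed

lemma Wiener_index_intersection_graph:
  "Wiener_index \<Gamma> =
    ereal ((1 / 2) * (3 * real p ^ 4 + 3 * real p ^ 3 + 5 * real p ^ 2 + 3 * real p + 2))"
proof -
  \<comment> \<open>There are 2 rotation groups, p groups of order 2p and p^2 groups of order 2,
    with one row sum for each kind.\<close>
  have "(\<Sum>H\<in>pverts \<Gamma>. \<Sum>K\<in>pverts \<Gamma>. dst H K) =
      2 * (1 + real p + 2 * real p ^ 2) + real p * (1 + 2 * real p ^ 2) +
      real p ^ 2 * (3 * real p ^ 2 + real p + 1)"
    unfolding sum_pverts[of "\<lambda>H. \<Sum>K\<in>pverts \<Gamma>. dst H K"]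
    by (simp add: sum_dst_Rot sum_dst_big sum_dst_small real_n)
  also have "\<dots> = 3 * real p ^ 4 + 3 * real p ^ 3 + 5 * real p ^ 2 + 3 * real p + 2"
    by (simp add: algebra_simps power2_eq_square power3_eq_cube power4_eq_xxxx)
  finally show ?thesis
    using Wiener_index_eq_sum[OF pair_graph_intersection_graph[OF finite_carrier], of dst]
      graph_dist_eq_dst by (simp add: dst_def)
qed

end

end

theorem theorem3p1:
  fixes p n :: nat
  assumes "Factorial_Ring.prime p" and "n = p ^ 2"
  shows "Wiener_index (intersection_graph (dihedral_group n)) =
    ereal ((1 / 2) * (3 * real p ^ 4 + 3 * real p ^ 3 + 5 * real p ^ 2 + 3 * real p + 2))"
proof -
  have "n > 0" using assms by (simp add: prime_gt_0_nat)
  then obtain rot ref where "dihedral (dihedral_group n) rot ref n"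
    by (rule dihedral_dihedral_group)
  then show ?thesis
    using assms by (rule dihedral.Wiener_index_intersection_graph)
qed

end
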